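(* Locally Minimal Defensive Alliance on the graphs of minimum degree at least 2 admits a kernel with at most ${f(k)}^{2k^2+4k}$ vertices for some computable function $f(k)$.
   Context: Let $G=(V,E)$ be a finite, simple, undirected graph. For $D\subseteq V$ and $v\in V$, let $d_D(v)$ denote the number of neighbours of $v$ in $D$, and $D^c=V\setminus D$. A non-empty set $D\subseteq V$ is a defensive alliance in $G$ if for each $v\in D$, $d_D(v)+1\geq d_{D^c}(v)$. A defensive alliance $D$ is locally minimal if for every $v\in D$, $D\setminus\{v\}$ is not a defensive alliance. The problem Locally Minimal Defensive Alliance is: given a graph $G$ and an integer $k$, does $G$ have a locally minimal defensive alliance $D$ with $|D|\geq k$? The parameter is the solution size $k$.
   Formalization: The parameter k is taken to be at least 1; for k = 0 the bound would be a single vertex, and no graph of minimum degree at least 2 with at most one vertex has a (non-empty) defensive alliance, so the claim fails there. *)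

theory Defs
  imports Complex_Main "HOL-Computational_Algebra.Polynomial"
begin

section \<open>Graphs and locally minimal defensive alliances\<close>

definition simple_graph :: "'a set \<Rightarrow> 'a set set \<Rightarrow> bool" where
  "simple_graph V E \<longleftrightarrow> finite V \<and> (\<forall>e\<in>E. e \<subseteq> V \<and> card e = 2)"

definition deg_in :: "'a set set \<Rightarrow> 'a set \<Rightarrow> 'a \<Rightarrow> nat" where
  "deg_in E D v = card {u \<in> D. {u, v} \<in> E}"

definition min_degree_ge :: "nat \<Rightarrow> 'a set \<Rightarrow> 'a set set \<Rightarrow> bool" where
  "min_degree_ge d V E \<longleftrightarrow> (\<forall>v\<in>V. d \<le> deg_in E V v)"

definition defensive_alliance :: "'a set \<Rightarrow> 'a set set \<Rightarrow> 'a set \<Rightarrow> bool" where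
  "defensive_alliance V E D \<longleftrightarrow>
     D \<noteq> {} \<and> D \<subseteq> V \<and> (\<forall>v\<in>D. deg_in E D v + 1 \<ge> deg_in E (V - D) v)"

definition locally_minimal_defensive_alliance :: "'a set \<Rightarrow> 'a set set \<Rightarrow> 'a set \<Rightarrow> bool" where
  "locally_minimal_defensive_alliance V E D \<longleftrightarrow>
     defensive_alliance V E D \<and> (\<forall>v\<in>D. \<not> defensive_alliance V E (D - {v}))"


section \<open>Model of computation\<close>

text \<open>
  Algorithms are programs of the WHILE language over binary trees (N. D. Jones,
  \<^emph>\<open>Computability and Complexity from a Programming Perspective\<close>), which is Turing complete.
  An assignment is charged the size of the tree it stores. Hence no value can be larger than
  the input plus the time used (up to a factor depending on the program), and running times are
  polynomially related to those of Turing machines.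
\<close>

datatype tree = Leaf | Node tree tree

fun left :: "tree \<Rightarrow> tree" where
  "left Leaf = Leaf"
| "left (Node l r) = l"

fun right :: "tree \<Rightarrow> tree" where
  "right Leaf = Leaf"
| "right (Node l r) = r"

datatype expr = Var nat | LeafE | NodeE expr expr | LeftE expr | RightE expr

datatype com = Assign nat expr | Seq com com | Cond expr com com | While expr com

type_synonym store = "nat \<Rightarrow> tree"

primrec eval_expr :: "expr \<Rightarrow> store \<Rightarrow> tree" where
  "eval_expr (Var x) s = s x"
| "eval_expr LeafE s = Leaf"
| "eval_expr (NodeE a b) s = Node (eval_expr a s) (eval_expr b s)"
| "eval_expr (LeftE a) s = left (eval_expr a s)"
| "eval_expr (RightE a) s = right (eval_expr a s)"

text \<open>\<open>exec c s t s'\<close>: started in store \<open>s\<close>, program \<open>c\<close> halts in store \<open>s'\<close> at cost \<open>t\<close>.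
  In tests, \<open>Leaf\<close> stands for false and every other tree for true.\<close>

inductive exec :: "com \<Rightarrow> store \<Rightarrow> nat \<Rightarrow> store \<Rightarrow> bool" where
  Assign: "exec (Assign x a) s (1 + size (eval_expr a s)) (s(x := eval_expr a s))"
| Seq: "exec c s t s' \<Longrightarrow> exec d s' t' s'' \<Longrightarrow> exec (Seq c d) s (t + t') s''"
| CondTrue: "eval_expr a s \<noteq> Leaf \<Longrightarrow> exec c s t s' \<Longrightarrow> exec (Cond a c d) s (1 + t) s'"
| CondFalse: "eval_expr a s = Leaf \<Longrightarrow> exec d s t s' \<Longrightarrow> exec (Cond a c d) s (1 + t) s'"
| WhileFalse: "eval_expr a s = Leaf \<Longrightarrow> exec (While a c) s 1 s"
| WhileTrue: "eval_expr a s \<noteq> Leaf \<Longrightarrow> exec c s t s' \<Longrightarrow> exec (While a c) s' t' s'' \<Longrightarrow>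
    exec (While a c) s (1 + t + t') s''"

text \<open>Input and output are passed in variable 0; all other variables start as \<open>Leaf\<close>.\<close>

definition runs :: "com \<Rightarrow> tree \<Rightarrow> nat \<Rightarrow> tree \<Rightarrow> bool" where
  "runs c x t y \<longleftrightarrow> (\<exists>s. exec c ((\<lambda>_. Leaf)(0 := x)) t s \<and> s 0 = y)"

primrec enc_nat :: "nat \<Rightarrow> tree" where
  "enc_nat 0 = Leaf"
| "enc_nat (Suc n) = Node Leaf (enc_nat n)"

primrec enc_list :: "tree list \<Rightarrow> tree" where
  "enc_list [] = Leaf"
| "enc_list (x # xs) = Node x (enc_list xs)"

definition enc_bool :: "bool \<Rightarrow> tree" where
  "enc_bool b = (if b then Node Leaf Leaf else Leaf)"

definition computable :: "(nat \<Rightarrow> nat) \<Rightarrow> bool" where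
  "computable f \<longleftrightarrow> (\<exists>c. \<forall>n. \<exists>t. runs c (enc_nat n) t (enc_nat (f n)))"

definition polytime_computable_on :: "'i set \<Rightarrow> ('i \<Rightarrow> tree) \<Rightarrow> ('i \<Rightarrow> 'i) \<Rightarrow> bool" where
  "polytime_computable_on I enc K \<longleftrightarrow>
     (\<exists>c (p :: nat poly). \<forall>x\<in>I. \<exists>t \<le> poly p (size (enc x)). runs c (enc x) t (enc (K x)))"


section \<open>Kernelization\<close>

text \<open>A parameterized problem is given by its set \<open>I\<close> of instances, the subset \<open>Y\<close> of
  yes-instances, an encoding of instances and the parameter of an instance.\<close>

definition kernelization ::
    "'i set \<Rightarrow> 'i set \<Rightarrow> ('i \<Rightarrow> tree) \<Rightarrow> ('i \<Rightarrow> nat) \<Rightarrow> ('i \<Rightarrow> 'i) \<Rightarrow> bool" where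
  "kernelization I Y enc par K \<longleftrightarrow>
     polytime_computable_on I enc K \<and>
     (\<forall>x\<in>I. K x \<in> I \<and> (K x \<in> Y \<longleftrightarrow> x \<in> Y)) \<and>
     (\<exists>g. computable g \<and> (\<forall>x\<in>I. size (enc (K x)) + par (K x) \<le> g (par x)))"

text \<open>An instance \<open>(n, E, k)\<close> consists of a graph with vertex set \<open>{..<n}\<close> and edge set \<open>E\<close>,
  encoded by its adjacency matrix, and the parameter \<open>k\<close>, encoded in unary, so that polynomial
  time means polynomial in the size of the graph and \<open>k\<close>. The parameter is positive: alliances
  are non-empty, and for \<open>k = 0\<close> the bound \<open>f k ^ (2 * k\<^sup>2 + 4 * k)\<close> would be 1, whereas every
  yes-instance of minimum degree at least 2 has at least 3 vertices.\<close>

type_synonym lmda_instance = "nat \<times> nat set set \<times> nat"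

definition num_vertices :: "lmda_instance \<Rightarrow> nat" where
  "num_vertices = (\<lambda>(n, E, k). n)"

definition parameter :: "lmda_instance \<Rightarrow> nat" where
  "parameter = (\<lambda>(n, E, k). k)"

definition enc_instance :: "lmda_instance \<Rightarrow> tree" where
  "enc_instance = (\<lambda>(n, E, k).
     Node (enc_list (map (\<lambda>i. enc_list (map (\<lambda>j. enc_bool ({i, j} \<in> E)) [0..<n])) [0..<n]))
          (enc_nat k))"

definition lmda_instances_min_degree_2 :: "lmda_instance set" where
  "lmda_instances_min_degree_2 =
     {(n, E, k). simple_graph {..<n} E \<and> min_degree_ge 2 {..<n} E \<and> k \<ge> 1}"

definition lmda_yes_instances_min_degree_2 :: "lmda_instance set" where
  "lmda_yes_instances_min_degree_2 =
     {(n, E, k) \<in> lmda_instances_min_degree_2.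
        \<exists>D. locally_minimal_defensive_alliance {..<n} E D \<and> card D \<ge> k}"

end

theory Submission
  imports Defs "HOL-Library.Discrete_Functions"
begin

text \<open>
  Every graph of minimum degree at least 2 with sufficiently many vertices (in terms of \<open>k\<close>) has a
  locally minimal defensive alliance with at least \<open>k\<close> vertices, so large instances can be replaced
  by a triangle with parameter 1, and small ones are their own kernel.

  A set \<open>D\<close> is an alliance iff every \<open>v \<in> D\<close> has at least \<open>\<lfloor>deg v / 2\<rfloor>\<close> neighbours in \<open>D\<close>; call \<open>v\<close>
  tight if equality holds. A vertex can be removed from an alliance iff it has no tight neighbour, so
  two adjacent tight vertices and all their neighbours survive every sequence of removals. Around each
  vertex \<open>x\<close> of an alliance, removals within distance 3 of \<open>x\<close> suffice to create such a pair. Hence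
  a large alliance of bounded degree, which has many vertices far apart, contains a large locally
  minimal one.

  Suppose there is no locally minimal alliance with \<open>k\<close> vertices. Then every large alliance contains
  a vertex of large degree. Shrink it to a minimal alliance containing such a vertex \<open>h\<close>. Then
  only \<open>h\<close> can be removed, all but fewer than \<open>k\<close> of the other vertices are adjacent to \<open>h\<close>, and
  removing \<open>h\<close> leaves an alliance that is still large. Repeating this \<open>2k\<close> times yields a vertex of
  degree less than \<open>2k\<close> that is adjacent to all the \<open>2k\<close> vertices \<open>h\<close>, a contradiction.
\<close>

section \<open>Large alliances in large graphs\<close>

locale min_degree_2_graph =
  fixes V :: "'a set" and E :: "'a set set"
  assumes simple: "simple_graph V E" and min_degree: "min_degree_ge 2 V E"
begin

abbreviation adj :: "'a \<Rightarrow> 'a \<Rightarrow> bool" where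
  "adj u v \<equiv> {u, v} \<in> E"

abbreviation deg :: "'a \<Rightarrow> nat" where
  "deg \<equiv> deg_in E V"

text \<open>Unlike \<open>defensive_alliance\<close>, this admits the empty set; nonemptiness is
  tracked separately.\<close>

definition alliance :: "'a set \<Rightarrow> bool" where
  "alliance D \<longleftrightarrow> D \<subseteq> V \<and> (\<forall>v\<in>D. deg v div 2 \<le> deg_in E D v)"

definition tight :: "'a set \<Rightarrow> 'a \<Rightarrow> bool" where
  "tight D v \<longleftrightarrow> v \<in> D \<and> deg_in E D v = deg v div 2"

text \<open>A tight neighbour is exactly what blocks a removal, by \<open>alliance_remove\<close>
  and \<open>tight_neighbour_not_removed\<close>.\<close>

definition locally_minimal :: "'a set \<Rightarrow> bool" where
  "locally_minimal D \<longleftrightarrow> alliance D \<and> (\<forall>v\<in>D. \<exists>u. tight D u \<and> adj u v)"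

definition paired :: "'a set \<Rightarrow> 'a \<Rightarrow> bool" where
  "paired D y \<longleftrightarrow> tight D y \<and> (\<exists>z. tight D z \<and> adj y z)"

definition frozen :: "'a set \<Rightarrow> 'a \<Rightarrow> bool" where
  "frozen D x \<longleftrightarrow> x \<in> D \<and> (\<exists>y. paired D y \<and> adj y x)"

text \<open>The set \<open>S\<close> confines the removals to a region, so that those around distant
  centres do not interfere.\<close>

inductive reach :: "'a set \<Rightarrow> 'a set \<Rightarrow> 'a set \<Rightarrow> bool" for S D where
  reach_refl: "reach S D D"
| reach_step: "reach S D D' \<Longrightarrow> v \<in> D' \<Longrightarrow> v \<in> S \<Longrightarrow> alliance (D' - {v}) \<Longrightarrow> reach S D (D' - {v})"

lemma finite_V: "finite V"
  using simple by (simp add: simple_graph_def)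

lemma adj_sym: "adj u v \<Longrightarrow> adj v u"
  by (simp add: insert_commute)

lemma not_adj_self: "\<not> adj v v"
  using simple by (fastforce simp: simple_graph_def)

lemma alliance_subset: "alliance D \<Longrightarrow> D \<subseteq> V"
  by (simp add: alliance_def)

lemma alliance_finite: "alliance D \<Longrightarrow> finite D"
  using finite_V finite_subset by (auto simp: alliance_def)

lemma deg_ge_2: "v \<in> V \<Longrightarrow> 2 \<le> deg v"
  using min_degree by (simp add: min_degree_ge_def)

lemma deg_in_mono: "finite D' \<Longrightarrow> D \<subseteq> D' \<Longrightarrow> deg_in E D v \<le> deg_in E D' v"
  unfolding deg_in_def by (rule card_mono) auto

section \<open>Removal of a single vertex\<close>

lemma deg_in_remove:
  assumes "finite D"
  shows "deg_in E (D - {v}) u = (if v \<in> D \<and> adj v u then deg_in E D u - 1 else deg_in E D u)"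
proof (cases "v \<in> D \<and> adj v u")
  case True
  have "{w \<in> D - {v}. adj w u} = {w \<in> D. adj w u} - {v}" by auto
  with True assms show ?thesis by (simp add: deg_in_def)
next
  case False
  then have "{w \<in> D - {v}. adj w u} = {w \<in> D. adj w u}" by auto
  then show ?thesis unfolding deg_in_def if_not_P[OF False] by simp
qed

lemma alliance_V: "alliance V"
  by (auto simp: alliance_def)

text \<open>A neighbour of \<open>v\<close> in \<open>D\<close> is not tight and so has a neighbour
  to spare; the other vertices lose nothing.\<close>

lemma alliance_remove:
  assumes "alliance D" "\<And>u. tight D u \<Longrightarrow> \<not> adj u v"
  shows "alliance (D - {v})"
proof -
  have "deg u div 2 \<le> deg_in E (D - {v}) u" if "u \<in> D" "u \<noteq> v" for u
  proof (cases "adj v u")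
    case True
    then have "\<not> tight D u" using assms(2) adj_sym by blast
    then have "deg_in E D u \<noteq> deg u div 2" using that by (simp add: tight_def)
    moreover have "deg u div 2 \<le> deg_in E D u" using assms(1) that by (simp add: alliance_def)
    ultimately show ?thesis using deg_in_remove[OF alliance_finite[OF assms(1)], of v u] True
      by (cases "v \<in> D") auto
  next
    case False
    then show ?thesis using deg_in_remove[OF alliance_finite[OF assms(1)]] assms(1) that
      by (simp add: alliance_def)
  qed
  then show ?thesis using assms(1) by (auto simp: alliance_def)
qed

text \<open>Minimum degree 2 makes the required number \<open>deg v div 2\<close> positive.\<close>

lemma alliance_neighbour:
  assumes "alliance D" "v \<in> D"
  obtains u where "u \<in> D" "adj u v"
proof -
  have "1 \<le> deg v div 2" using deg_ge_2[of v] assms by (auto simp: alliance_def)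
  also have "\<dots> \<le> deg_in E D v" using assms by (simp add: alliance_def)
  finally have "{u \<in> D. adj u v} \<noteq> {}" unfolding deg_in_def by (metis card.empty not_one_le_zero)
  then show ?thesis using that by blast
qed

text \<open>A tight neighbour of \<open>v\<close> would fall below its required number, which is
  positive, so the truncated subtraction is a true decrease.\<close>

lemma tight_neighbour_not_removed:
  assumes "finite D" "alliance (D - {v})" "tight D u" "v \<in> D"
  shows "\<not> adj u v"
proof
  assume a: "adj u v"
  then have "u \<noteq> v" using not_adj_self by auto
  with assms have "u \<in> D - {v}" by (auto simp: tight_def)
  then have "deg u div 2 \<le> deg_in E (D - {v}) u" "1 \<le> deg u div 2"
    using assms(2) deg_ge_2[of u] by (auto simp: alliance_def)
  moreover have "deg_in E (D - {v}) u = deg u div 2 - 1"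
    using deg_in_remove[OF assms(1)] assms(3,4) adj_sym[OF a] by (simp add: tight_def)
  ultimately show False by linarith
qed

lemma tight_remove:
  assumes "finite D" "alliance (D - {v})" "tight D u" "v \<in> D" "u \<noteq> v"
  shows "tight (D - {v}) u"
  using tight_neighbour_not_removed[OF assms(1-4)] assms deg_in_remove[OF assms(1), of v u] adj_sym
  by (auto simp: tight_def)

text \<open>The two tight vertices of a pair protect each other from removal.\<close>

lemma paired_remove:
  assumes "finite D" "alliance (D - {v})" "v \<in> D" "paired D y"
  shows "paired (D - {v}) y"
proof -
  obtain z where z: "tight D y" "tight D z" "adj y z" using assms(4) by (auto simp: paired_def)
  have "y \<noteq> v" using tight_neighbour_not_removed[OF assms(1,2) z(2) assms(3)] z(3) adj_sym by blast
  moreover have "z \<noteq> v" using tight_neighbour_not_removed[OF assms(1,2) z(1) assms(3)] z(3) by blast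
  ultimately show ?thesis using tight_remove[OF assms(1,2)] z assms(3) by (auto simp: paired_def)
qed

lemma frozen_remove:
  assumes "finite D" "alliance (D - {v})" "v \<in> D" "frozen D x"
  shows "frozen (D - {v}) x"
proof -
  obtain y where y: "paired D y" "adj y x" "x \<in> D" using assms(4) by (auto simp: frozen_def)
  have "x \<noteq> v" using tight_neighbour_not_removed[OF assms(1,2) _ assms(3), of y] y
    by (auto simp: paired_def)
  then show ?thesis using paired_remove[OF assms(1-3) y(1)] y by (auto simp: frozen_def)
qed

section \<open>Sequences of removals\<close>

text \<open>All invariants of removal sequences in one induction. The set stays nonempty because a
  removed vertex leaves a neighbour behind.\<close>

lemma reach_props:
  assumes "reach S D D'" "alliance D"
  shows "alliance D' \<and> D' \<subseteq> D \<and> D - D' \<subseteq> S \<and> (D \<noteq> {} \<longrightarrow> D' \<noteq> {}) \<and>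
    (\<forall>y. paired D y \<longrightarrow> paired D' y) \<and> (\<forall>x. frozen D x \<longrightarrow> frozen D' x)"
  using assms
proof induction
  case (reach_step D' v)
  then have f: "finite D'" using alliance_finite by blast
  obtain u where "u \<in> D'" "adj u v" using alliance_neighbour[of D' v] reach_step by blast
  then have "D' - {v} \<noteq> {}" using not_adj_self by blast
  then show ?case using reach_step paired_remove[OF f] frozen_remove[OF f] by blast
qed auto

lemmas reach_alliance = reach_props[THEN conjunct1]
lemmas reach_subset = reach_props[THEN conjunct2, THEN conjunct1]
lemmas reach_removed = reach_props[THEN conjunct2, THEN conjunct2, THEN conjunct1]
lemmas reach_nonempty = reach_props[THEN conjunct2, THEN conjunct2, THEN conjunct2, THEN conjunct1, rule_format]
lemmas reach_paired = reach_props[THEN conjunct2, THEN conjunct2, THEN conjunct2, THEN conjunct2,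
    THEN conjunct1, rule_format]
lemmas reach_frozen = reach_props[THEN conjunct2, THEN conjunct2, THEN conjunct2, THEN conjunct2,
    THEN conjunct2, rule_format]

lemma reach_trans:
  assumes "reach S D' D''" "reach S D D'"
  shows "reach S D D''"
  using assms by induction (auto intro: reach_step)

lemma reach_mono: "reach S D D' \<Longrightarrow> S \<subseteq> T \<Longrightarrow> reach T D D'"
  by (induction rule: reach.induct) (auto intro: reach.intros)

text \<open>A reachable set of least cardinality works: a vertex of \<open>S\<close> without tight
  neighbour could still be removed.\<close>

lemma reach_stuck:
  assumes "alliance D"
  obtains D' where "reach S D D'" "\<And>v. v \<in> D' \<Longrightarrow> v \<in> S \<Longrightarrow> \<exists>u. tight D' u \<and> adj u v"
proof -
  have "\<exists>D'. reach S D D' \<and> (\<forall>D''. reach S D D'' \<longrightarrow> card D' \<le> card D'')"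
    using ex_has_least_nat[of "reach S D" D card] reach_refl by blast
  then obtain D' where D': "reach S D D'" "\<And>D''. reach S D D'' \<Longrightarrow> card D' \<le> card D''" by blast
  have all: "alliance D'" using reach_alliance D' assms by blast
  have "\<exists>u. tight D' u \<and> adj u v" if v: "v \<in> D'" "v \<in> S" for v
  proof (rule ccontr)
    assume "\<not> ?thesis"
    then have "alliance (D' - {v})" using alliance_remove[OF all] by blast
    then have "card D' \<le> card (D' - {v})" using D' v reach_step by blast
    then show False using card_Diff1_less[OF alliance_finite[OF all] v(1)] by simp
  qed
  then show ?thesis using that D' by blast
qed

lemma reach_locally_minimal:
  assumes "alliance D"
  obtains D' where "reach UNIV D D'" "locally_minimal D'"
  using reach_stuck[OF assms, of UNIV] reach_alliance[OF _ assms] unfolding locally_minimal_def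
  by (metis UNIV_I)

section \<open>Balls in the subgraph induced by an alliance\<close>

text \<open>Including \<open>Id\<close> makes the \<open>r\<close>-th power relate vertices at
  distance at most \<open>r\<close>.\<close>

definition link :: "'a set \<Rightarrow> ('a \<times> 'a) set" where
  "link D = Id \<union> {(u, w). u \<in> D \<and> w \<in> D \<and> adj u w}"

definition ball :: "'a set \<Rightarrow> nat \<Rightarrow> 'a \<Rightarrow> 'a set" where
  "ball D r x = (link D ^^ r) `` {x}"

lemma ball_0 [simp]: "ball D 0 x = {x}"
  by (auto simp: ball_def)

lemma ball_Suc: "ball D (Suc r) x = link D `` ball D r x"
  by (auto simp: ball_def)

lemma ball_step: "y \<in> ball D r x \<Longrightarrow> adj y z \<Longrightarrow> y \<in> D \<Longrightarrow> z \<in> D \<Longrightarrow> z \<in> ball D (Suc r) x"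
  by (auto simp: ball_Suc link_def)

lemma ball_mono_Suc: "ball D r x \<subseteq> ball D (Suc r) x"
  by (auto simp: ball_Suc link_def)

lemma ball_mono: "r \<le> r' \<Longrightarrow> ball D r x \<subseteq> ball D r' x"
  by (rule lift_Suc_mono_le[of "\<lambda>r. ball D r x"]) (auto simp: ball_mono_Suc[THEN subsetD])

lemma ball_center: "x \<in> ball D r x"
  using ball_mono[of 0 r] by auto

lemma link_relpow_sym: "(x, y) \<in> link D ^^ r \<Longrightarrow> (y, x) \<in> link D ^^ r"
proof (induction r arbitrary: y)
  case (Suc r)
  then obtain z where "(x, z) \<in> link D ^^ r" "(z, y) \<in> link D" by auto
  moreover from this(2) have "(y, z) \<in> link D" using adj_sym by (auto simp: link_def)
  ultimately show ?case using Suc.IH relpow_Suc_I2 by metis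
qed auto

lemma balls_disjoint:
  assumes "y \<notin> ball D (r + r) x"
  shows "ball D r x \<inter> ball D r y = {}"
proof (rule ccontr)
  assume "\<not> ?thesis"
  then obtain z where "(x, z) \<in> link D ^^ r" "(y, z) \<in> link D ^^ r" by (auto simp: ball_def)
  then have "(x, y) \<in> link D ^^ r O link D ^^ r" using link_relpow_sym by blast
  then show False using assms by (auto simp: ball_def relpow_add)
qed

text \<open>Each step replaces a vertex by itself and its fewer than \<open>d\<close> neighbours;
  \<open>max 1 d\<close> also covers \<open>d = 0\<close>, where \<open>D\<close> is empty.\<close>

lemma card_ball:
  assumes "finite D" "\<And>u. u \<in> D \<Longrightarrow> deg_in E D u < d"
  shows "finite (ball D r x) \<and> card (ball D r x) \<le> max 1 d ^ r"
proof (induction r)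
  case (Suc r)
  have link_card: "finite (link D `` {u}) \<and> card (link D `` {u}) \<le> max 1 d" for u
  proof (cases "u \<in> D")
    case True
    have "link D `` {u} = insert u {w \<in> D. adj w u}"
      using True by (auto simp: link_def insert_commute)
    then show ?thesis using assms(1) assms(2)[OF True] card_insert_le_m1[of "max 1 d" "{w \<in> D. adj w u}" u]
      by (auto simp: deg_in_def card_insert_if)
  next
    case False
    then have "link D `` {u} = {u}" by (auto simp: link_def)
    then show ?thesis by simp
  qed
  have eq: "ball D (Suc r) x = (\<Union>u\<in>ball D r x. link D `` {u})" by (auto simp: ball_Suc)
  have "card (ball D (Suc r) x) \<le> (\<Sum>u\<in>ball D r x. card (link D `` {u}))"
    unfolding eq using Suc by (intro card_UN_le) auto
  also have "\<dots> \<le> card (ball D r x) * max 1 d"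
    using sum_bounded_above[of "ball D r x" "\<lambda>u. card (link D `` {u})" "max 1 d"] link_card by simp
  also have "\<dots> \<le> max 1 d ^ r * max 1 d" using Suc by (intro mult_le_mono1) simp
  finally show ?case using link_card Suc by (auto simp: eq mult.commute)
qed simp

section \<open>Freezing vertices around scattered centres\<close>

text \<open>First remove what is possible in the ball, sparing \<open>x\<close>. If a tight vertex
  other than \<open>x\<close> remains there, it has a tight neighbour. Otherwise \<open>x\<close>
  and its neighbours form a component; then \<open>x\<close> can go and removals continue among its
  neighbours. Balls are taken in \<open>D0\<close> so that they stay fixed while \<open>D\<close>
  shrinks.\<close>

lemma local_freezing:
  assumes "alliance D" "D \<subseteq> D0" "x \<in> D"
  obtains D' y where "reach (ball D0 3 x) D D'" "paired D' y" "y \<in> ball D0 3 x"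
proof -
  let ?B = "\<lambda>r. ball D0 r x"
  obtain D1 where D1: "reach (?B 3 - {x}) D D1"
    "\<And>v. v \<in> D1 \<Longrightarrow> v \<in> ?B 3 - {x} \<Longrightarrow> \<exists>u. tight D1 u \<and> adj u v"
    using reach_stuck[OF assms(1)] by blast
  have all1: "alliance D1" using reach_alliance[OF D1(1) assms(1)] .
  have sub1: "D1 \<subseteq> D0" using reach_subset[OF D1(1) assms(1)] assms(2) by simp
  have x1: "x \<in> D1" using reach_removed[OF D1(1) assms(1)] assms(3) by auto
  have r1: "reach (?B 3) D D1" using D1(1) reach_mono by blast
  have nb: "z \<in> ?B (Suc r)" if "y \<in> ?B r" "y \<in> D1" "z \<in> D1" "adj y z" for y z r
    using ball_step[of y D0 r x z] that sub1 by blast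
  have sub: "?B 1 \<subseteq> ?B 3" "?B 2 \<subseteq> ?B 3" by (simp_all add: ball_mono)
  show ?thesis
  proof (cases "\<exists>z. tight D1 z \<and> z \<in> ?B 3 - {x}")
    case True
    then obtain z where z: "tight D1 z" "z \<in> ?B 3 - {x}" by blast
    then have "z \<in> D1" by (simp add: tight_def)
    from D1(2)[OF this z(2)] obtain u where "tight D1 u" "adj u z" by blast
    then have "paired D1 z" using z(1) adj_sym by (auto simp: paired_def)
    then show ?thesis using that r1 z(2) by blast
  next
    case False
    then have only_x: "z = x" if "tight D1 z" "z \<in> ?B 3" for z using that by blast
    \<comment> \<open>The tight neighbour of \<open>w\<close> lies within distance 3 of
      \<open>x\<close>, so it can only be \<open>x\<close>.\<close>
    have step: "adj x w" if w: "w \<in> D1" "w \<in> ?B 2" "w \<noteq> x" for w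
    proof -
      have "w \<in> ?B 3 - {x}" using w sub by blast
      from D1(2)[OF w(1) this] obtain z where z: "tight D1 z" "adj z w" by blast
      then have "z \<in> ?B 3" using nb[of w 2 z] w adj_sym by (simp add: tight_def numeral_3_eq_3)
      then show ?thesis using only_x z by blast
    qed
    let ?C = "{w \<in> D1. adj x w}"
    have C1: "?C \<subseteq> ?B 1" using nb[of x 0] x1 by auto
    have xC: "x \<notin> ?C" using not_adj_self by blast
    have closed: "w \<in> insert x ?C" if "u \<in> ?C" "w \<in> D1" "adj u w" for u w
      using step[of w] nb[of u 1 w] that C1 by (auto simp: numeral_2_eq_2)
    have not_tight: "\<not> tight D1 u" if "u \<in> ?C" for u
      using only_x[of u] that C1 sub xC by blast
    have all2: "alliance (D1 - {x})"
      using alliance_remove[OF all1, of x] not_tight adj_sym by (auto simp: tight_def)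
    have C_ne: "?C \<noteq> {}" using alliance_neighbour[OF all1 x1] adj_sym by blast
    obtain D2 where D2: "reach ?C (D1 - {x}) D2"
      "\<And>v. v \<in> D2 \<Longrightarrow> v \<in> ?C \<Longrightarrow> \<exists>u. tight D2 u \<and> adj u v"
      using reach_stuck[OF all2] by blast
    \<comment> \<open>A vertex of \<open>?C\<close> is removed only while a neighbour remains, and
      without \<open>x\<close> this neighbour lies in \<open>?C\<close>; so \<open>?C\<close> is
      never exhausted.\<close>
    have "D2 \<inter> ?C \<noteq> {} \<and> D2 \<subseteq> D1 - {x} \<and> alliance D2" using D2(1)
    proof induction
      case reach_refl
      then show ?case using C_ne xC all2 by blast
    next
      case (reach_step D' v)
      then obtain w where w: "w \<in> D'" "adj w v" using alliance_neighbour[of D' v] by blast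
      then have "w \<in> ?C" using closed[of v w] reach_step adj_sym by blast
      moreover have "w \<noteq> v" using w not_adj_self by blast
      ultimately show ?case using w reach_step by blast
    qed
    then obtain u where u: "u \<in> D2" "u \<in> ?C" and sub2: "D2 \<subseteq> D1 - {x}" by blast
    then obtain y where y: "tight D2 y" "adj y u" using D2(2) by blast
    then have yD: "y \<in> D2" by (simp add: tight_def)
    then have yC: "y \<in> ?C" using closed[of u y] u y adj_sym sub2 by blast
    then obtain z where "tight D2 z" "adj z y" using D2(2) yD by blast
    then have "paired D2 y" using y adj_sym by (auto simp: paired_def)
    moreover have "reach (?B 3) D1 (D1 - {x})"
      using reach_step[OF reach_refl x1 ball_center all2] .
    then have "reach (?B 3) D D2"
      using r1 D2(1) reach_mono[of ?C _ _ "?B 3"] C1 sub reach_trans by (meson subset_trans)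
    ultimately show ?thesis using that yC C1 sub by blast
  qed
qed

text \<open>Centres are treated one by one: by disjointness the next centre has not been removed
  yet, and paired vertices stay paired.\<close>

lemma scattered_freezing:
  assumes "alliance D0" "finite X" "X \<subseteq> D0"
    "pairwise (\<lambda>x y. ball D0 3 x \<inter> ball D0 3 y = {}) X"
  shows "\<exists>D. reach (\<Union>x\<in>X. ball D0 3 x) D0 D \<and> (\<forall>x\<in>X. \<exists>y \<in> ball D0 3 x. paired D y)"
  using assms(2-)
proof (induction X rule: finite_induct)
  case empty
  then show ?case using reach_refl by blast
next
  case (insert x X)
  then have disj: "ball D0 3 x \<inter> ball D0 3 y = {}" if "y \<in> X" for y
    using that by (auto simp: pairwise_insert)
  have "X \<subseteq> D0" using insert.prems(1) by simp
  from insert.IH[OF this pairwise_subset[OF insert.prems(2) subset_insertI]]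
  obtain D where D: "reach (\<Union>x\<in>X. ball D0 3 x) D0 D" "\<forall>x\<in>X. \<exists>y \<in> ball D0 3 x. paired D y"
    by blast
  have "x \<notin> (\<Union>x\<in>X. ball D0 3 x)" using disj ball_center[of x D0 3] by blast
  then have "x \<in> D" using reach_removed[OF D(1) assms(1)] insert.prems(1) by blast
  moreover have all: "alliance D" "D \<subseteq> D0"
    using reach_alliance[OF D(1) assms(1)] reach_subset[OF D(1) assms(1)] by blast+
  ultimately obtain D' y where D': "reach (ball D0 3 x) D D'" "paired D' y" "y \<in> ball D0 3 x"
    using local_freezing by blast
  let ?S = "\<Union>x\<in>insert x X. ball D0 3 x"
  have "reach ?S D0 D'"
    using reach_trans[OF reach_mono[OF D'(1)] reach_mono[OF D(1)], of ?S] by blast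
  moreover have "\<exists>y \<in> ball D0 3 z. paired D' y" if "z \<in> insert x X" for z
    using that D'(2,3) D(2) reach_paired[OF D'(1) all(1)] by auto
  ultimately show ?case by blast
qed

text \<open>Greedy choice: balls of radius 6 = 3 + 3 around fewer than \<open>k\<close> centres
  cover fewer than \<open>k * d ^ 6\<close> vertices, and any uncovered vertex can be added.\<close>

lemma scattered_exists:
  assumes "finite D" "\<And>u. u \<in> D \<Longrightarrow> deg_in E D u < d" "1 \<le> d" "k * d ^ 6 \<le> card D" "j \<le> k"
  shows "\<exists>X \<subseteq> D. card X = j \<and> finite X \<and> pairwise (\<lambda>x y. ball D 3 x \<inter> ball D 3 y = {}) X"
  using assms(5)
proof (induction j)
  case 0
  show ?case by (intro exI[of _ "{}"]) auto
next
  case (Suc j)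
  then obtain X where X: "X \<subseteq> D" "card X = j" "finite X"
    "pairwise (\<lambda>x y. ball D 3 x \<inter> ball D 3 y = {}) X" by auto
  have cb: "finite (ball D 6 x) \<and> card (ball D 6 x) \<le> d ^ 6" for x
    using card_ball[OF assms(1,2), where r = 6] assms(3) by (simp add: max_def split: if_splits)
  have "card (\<Union>x\<in>X. ball D 6 x) \<le> (\<Sum>x\<in>X. card (ball D 6 x))"
    using X(3) by (rule card_UN_le)
  also have "\<dots> \<le> j * d ^ 6" using sum_bounded_above[of X "\<lambda>x. card (ball D 6 x)" "d ^ 6"] cb X by simp
  also have "\<dots> < k * d ^ 6" using Suc.prems assms(3) by simp
  also note assms(4)
  finally have "\<not> D \<subseteq> (\<Union>x\<in>X. ball D 6 x)"
    using card_mono[of "\<Union>x\<in>X. ball D 6 x" D] cb X(3) by fastforce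
  then obtain y where y: "y \<in> D" "\<And>x. x \<in> X \<Longrightarrow> y \<notin> ball D 6 x" by blast
  then have "ball D 3 x \<inter> ball D 3 y = {}" if "x \<in> X" for x
    using balls_disjoint[of y D 3 x] that by simp
  then have "pairwise (\<lambda>x y. ball D 3 x \<inter> ball D 3 y = {}) (insert y X)"
    using X(4) by (auto simp: pairwise_insert Int_commute)
  moreover have "y \<notin> X" using y(2) ball_center by blast
  ultimately show ?case using X y(1) by (intro exI[of _ "insert y X"]) auto
qed

text \<open>Each of \<open>k\<close> scattered centres yields a paired vertex in its own ball, and
  these survive until the alliance is locally minimal.\<close>

lemma bounded_degree_large:
  assumes "alliance D" "\<And>u. u \<in> D \<Longrightarrow> deg_in E D u < d" "1 \<le> d" "k * d ^ 6 \<le> card D"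
  shows "\<exists>D'. locally_minimal D' \<and> k \<le> card D'"
proof -
  obtain X where X: "X \<subseteq> D" "card X = k" "finite X"
    "pairwise (\<lambda>x y. ball D 3 x \<inter> ball D 3 y = {}) X"
    using scattered_exists[OF alliance_finite[OF assms(1)] assms(2-4), of k] by auto
  obtain D1 where D1: "reach (\<Union>x\<in>X. ball D 3 x) D D1" "\<forall>x\<in>X. \<exists>y \<in> ball D 3 x. paired D1 y"
    using scattered_freezing[OF assms(1) X(3,1,4)] by blast
  have all: "alliance D1" using reach_alliance[OF D1(1) assms(1)] .
  obtain D2 where D2: "reach UNIV D1 D2" "locally_minimal D2" using reach_locally_minimal[OF all] .
  have "\<exists>y \<in> ball D 3 x. y \<in> D2" if "x \<in> X" for x
    using D1(2) that reach_paired[OF D2(1) all] by (fastforce simp: paired_def tight_def)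
  then obtain g where g: "\<And>x. x \<in> X \<Longrightarrow> g x \<in> ball D 3 x \<and> g x \<in> D2" by metis
  have "inj_on g X"
    using g X(4) unfolding inj_on_def pairwise_def by (metis IntI empty_iff)
  moreover have "g ` X \<subseteq> D2" using g by blast
  moreover have "finite D2" using D2(2) alliance_finite by (auto simp: locally_minimal_def)
  ultimately have "k \<le> card D2" using X(2) card_inj_on_le by blast
  then show ?thesis using D2 by blast
qed

section \<open>Vertices of large degree\<close>

text \<open>Choose \<open>D'\<close> of least cardinality among the reachable alliances with a
  vertex \<open>h\<close> of degree at least \<open>2 * T\<close>. Every other vertex has a tight
  neighbour, since its removal would keep \<open>h\<close>.\<close>

lemma hub:
  assumes no_large: "\<And>D. locally_minimal D \<Longrightarrow> card D < k"
    and "alliance D" "v \<in> D" "2 * T \<le> deg v" "k \<le> T"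
  obtains D' h where "reach UNIV D D'" "h \<in> D'" "alliance (D' - {h})" "T \<le> card (D' - {h})"
    "\<And>u. u \<in> D' - {h} \<Longrightarrow> deg u < 2 * T"
    "\<And>x. x \<in> D' - {h} \<Longrightarrow> adj h x \<or> frozen D' x"
proof -
  let ?P = "\<lambda>D'. reach UNIV D D' \<and> (\<exists>h\<in>D'. 2 * T \<le> deg h)"
  have "\<exists>D'. ?P D' \<and> (\<forall>D''. ?P D'' \<longrightarrow> card D' \<le> card D'')"
    using ex_has_least_nat[of ?P D card] reach_refl assms(3,4) by blast
  then obtain D' h where D': "reach UNIV D D'" "\<And>D''. ?P D'' \<Longrightarrow> card D' \<le> card D''"
    and h: "h \<in> D'" "2 * T \<le> deg h" by blast
  have all: "alliance D'" using reach_alliance[OF D'(1) assms(2)] .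
  note fin = alliance_finite[OF all]
  have less: "\<not> ?P (D' - {u})" if "u \<in> D'" for u
    using D'(2)[of "D' - {u}"] card_Diff1_less[OF fin that] by linarith
  have stuck: "\<exists>w. tight D' w \<and> adj w u" if "u \<in> D'" "u \<noteq> h" for u
  proof (rule ccontr)
    assume "\<not> ?thesis"
    then have "alliance (D' - {u})" using alliance_remove[OF all] by blast
    then have "?P (D' - {u})" using reach_step[OF D'(1) that(1)] h that by blast
    then show False using less that by blast
  qed
  have "T \<le> deg_in E D' h" using all h by (fastforce simp: alliance_def)
  also have "\<dots> \<le> card (D' - {h})" unfolding deg_in_def
    using fin not_adj_self by (intro card_mono) auto
  finally have card: "T \<le> card (D' - {h})" .
  \<comment> \<open>If \<open>h\<close> were blocked as well, \<open>D'\<close> would be locally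
    minimal with more than \<open>T \<ge> k\<close> vertices.\<close>
  have free: "\<not> adj w h" if "tight D' w" for w
  proof
    assume "adj w h"
    then have "locally_minimal D'" using stuck that all unfolding locally_minimal_def by blast
    then have "card D' < k" by (rule no_large)
    then show False using card assms(5) card_Diff1_less[OF fin h(1)] by linarith
  qed
  have all': "alliance (D' - {h})" using alliance_remove[OF all] free by blast
  have "adj h x \<or> frozen D' x" if x: "x \<in> D' - {h}" for x
  proof -
    obtain w where w: "tight D' w" "adj w x" using stuck x by blast
    show ?thesis
    proof (cases "w = h")
      \<comment> \<open>A tight neighbour \<open>w\<close> other than \<open>h\<close> is itself
        blocked by a tight vertex, so \<open>w\<close> is paired and freezes
        \<open>x\<close>.\<close>
      case False
      then obtain z where "tight D' z" "adj z w" using stuck[of w] w(1) by (auto simp: tight_def)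
      then have "paired D' w" using w(1) adj_sym by (auto simp: paired_def)
      then show ?thesis using w(2) x by (auto simp: frozen_def)
    qed (use w in blast)
  qed
  moreover have "deg u < 2 * T" if "u \<in> D' - {h}" for u
    using less[OF h(1)] reach_step[OF D'(1) h(1) _ all'] that by (meson UNIV_I not_le)
  ultimately show ?thesis using that D'(1) h(1) all' card by blast
qed

end

text \<open>The step is \<open>bounded_degree_large\<close> with
  \<open>d = 2 * size_bound k j\<close>: an alliance of this size has a vertex of degree at least
  \<open>d\<close>, unless there is a locally minimal one with \<open>k\<close> vertices.\<close>

primrec size_bound :: "nat \<Rightarrow> nat \<Rightarrow> nat" where
  "size_bound k 0 = k"
| "size_bound k (Suc j) = k * (2 * size_bound k j) ^ 6"

lemma size_bound_ge: "1 \<le> k \<Longrightarrow> k \<le> size_bound k j"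
  by (induction j) auto

context min_degree_2_graph
begin

text \<open>Each of \<open>j\<close> rounds removes a hub. Frozen vertices stay frozen, so a vertex
  \<open>x\<close> not frozen at the end never was, and is adjacent to every hub. The degree bound
  assumed for \<open>j = 0\<close> is provided by the last hub, where
  \<open>T = size_bound k 0 = k\<close>.\<close>

lemma nested_hubs:
  assumes no_large: "\<And>D. locally_minimal D \<Longrightarrow> card D < k" and "1 \<le> k"
    and "alliance D" "size_bound k j \<le> card D" "j = 0 \<Longrightarrow> \<forall>u\<in>D. deg u < 2 * k"
  shows "\<exists>D' x. reach UNIV D D' \<and> x \<in> D' \<and> \<not> frozen D' x \<and> deg x < 2 * k \<and> j \<le> deg_in E D x"
  using assms(3-)
proof (induction j arbitrary: D)
  case 0
  obtain D' where D': "reach UNIV D D'" "locally_minimal D'" using reach_locally_minimal[OF 0(1)] .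
  \<comment> \<open>All frozen vertices survive into a locally minimal set, so they are fewer than
    \<open>k\<close> and \<open>D\<close> has an unfrozen vertex.\<close>
  have "{x. frozen D x} \<subseteq> D'" using reach_frozen[OF D'(1) 0(1)] by (auto simp: frozen_def)
  moreover have "finite D'" using D'(2) alliance_finite by (auto simp: locally_minimal_def)
  ultimately have f: "finite {x. frozen D x}" "card {x. frozen D x} < card D"
    using card_mono[of D' "{x. frozen D x}"] no_large[OF D'(2)] 0(2) finite_subset by auto
  then have "\<not> D \<subseteq> {x. frozen D x}" using card_mono by (meson not_le)
  then obtain x where "x \<in> D" "\<not> frozen D x" by blast
  then show ?case using 0(3) reach_refl by (intro exI[of _ D] exI[of _ x]) auto
next
  case (Suc j)
  let ?T = "size_bound k j"
  have T: "k \<le> ?T" using size_bound_ge[OF assms(2)] .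
  have "\<exists>v\<in>D. 2 * ?T \<le> deg v"
  proof (rule ccontr)
    assume *: "\<not> ?thesis"
    have "deg_in E D v < 2 * ?T" if "v \<in> D" for v
      using * that deg_in_mono[OF finite_V alliance_subset[OF Suc.prems(1)], of v] by fastforce
    then show False
      using bounded_degree_large[OF Suc.prems(1), of "2 * ?T" k] Suc.prems(2) T assms(2) no_large
      by (fastforce simp: not_le)
  qed
  then obtain v where v: "v \<in> D" "2 * ?T \<le> deg v" by blast
  obtain D1 h where D1: "reach UNIV D D1" "h \<in> D1" "alliance (D1 - {h})" "?T \<le> card (D1 - {h})"
    "\<And>u. u \<in> D1 - {h} \<Longrightarrow> deg u < 2 * ?T" "\<And>x. x \<in> D1 - {h} \<Longrightarrow> adj h x \<or> frozen D1 x"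
    using hub[OF no_large Suc.prems(1) v T] by blast
  have "j = 0 \<Longrightarrow> \<forall>u\<in>D1 - {h}. deg u < 2 * k" using D1(5) by simp
  from Suc.IH[OF D1(3,4) this] obtain D' x where D': "reach UNIV (D1 - {h}) D'" "x \<in> D'"
    "\<not> frozen D' x" "deg x < 2 * k" "j \<le> deg_in E (D1 - {h}) x" by blast
  have r: "reach UNIV D1 D'" using reach_trans[OF D'(1) reach_step[OF reach_refl D1(2) _ D1(3)]] by simp
  have all: "alliance D1" using reach_alliance[OF D1(1) Suc.prems(1)] .
  have "x \<in> D1 - {h}" using reach_subset[OF D'(1) D1(3)] D'(2) by blast
  moreover have "\<not> frozen D1 x" using reach_frozen[OF r all] D'(3) by blast
  ultimately have "adj h x" using D1(6) by blast
  then have "deg_in E D1 x = Suc (deg_in E (D1 - {h}) x)"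
    using deg_in_remove[OF alliance_finite[OF all], of h x] D1(2)
      card_gt_0_iff[of "{u \<in> D1. adj u x}"] alliance_finite[OF all]
    by (auto simp: deg_in_def)
  then have "Suc j \<le> deg_in E D1 x" using D'(5) by simp
  also have "\<dots> \<le> deg_in E D x"
    using deg_in_mono[OF alliance_finite[OF Suc.prems(1)] reach_subset[OF D1(1) Suc.prems(1)]] .
  finally show ?case using D' reach_trans[OF r D1(1)] by blast
qed

text \<open>For \<open>D = V\<close> and \<open>j = 2 * k\<close>, a counterexample would contain
  \<open>x\<close> with \<open>2 * k \<le> deg x < 2 * k\<close>.\<close>

lemma large_locally_minimal:
  assumes "1 \<le> k" "size_bound k (2 * k) \<le> card V"
  shows "\<exists>D. locally_minimal D \<and> k \<le> card D"
proof (rule ccontr)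
  assume "\<not> ?thesis"
  then have "card D < k" if "locally_minimal D" for D using that by force
  from nested_hubs[OF this assms(1) alliance_V assms(2)] assms(1) show False by fastforce
qed

section \<open>Return to defensive alliances\<close>

text \<open>With \<open>d = deg_in E D v\<close>, the alliance inequality is
  \<open>deg v - d \<le> d + 1\<close>, equivalent to \<open>deg v div 2 \<le> d\<close>.\<close>

lemma locally_minimal_imp:
  assumes "locally_minimal D" "D \<noteq> {}"
  shows "locally_minimal_defensive_alliance V E D"
proof -
  have all: "alliance D" using assms(1) by (simp add: locally_minimal_def)
  have compl: "deg_in E (V - D) v = deg v - deg_in E D v" if "D \<subseteq> V" for D v
  proof -
    have "{u \<in> V - D. adj u v} = {u \<in> V. adj u v} - {u \<in> D. adj u v}" by auto
    then show ?thesis unfolding deg_in_def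
      using that finite_V finite_subset[OF that finite_V] by (auto intro!: card_Diff_subset)
  qed
  have "defensive_alliance V E D"
    unfolding defensive_alliance_def
  proof (intro conjI ballI)
    show "D \<subseteq> V" using alliance_subset[OF all] .
    fix v assume "v \<in> D"
    then have "deg v div 2 \<le> deg_in E D v" using all by (simp add: alliance_def)
    then show "deg_in E (V - D) v \<le> deg_in E D v + 1" using compl[OF alliance_subset[OF all]] by simp
  qed (use assms in auto)
  moreover have "\<not> defensive_alliance V E (D - {v})" if v: "v \<in> D" for v
  proof
    assume "defensive_alliance V E (D - {v})"
    then have sub: "D - {v} \<subseteq> V"
      and d: "\<And>u. u \<in> D - {v} \<Longrightarrow> deg_in E (V - (D - {v})) u \<le> deg_in E (D - {v}) u + 1"
      by (auto simp: defensive_alliance_def)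
    have "deg u div 2 \<le> deg_in E (D - {v}) u" if "u \<in> D - {v}" for u
      using d[OF that] compl[OF sub, of u] by linarith
    then have "alliance (D - {v})" using sub by (simp add: alliance_def)
    moreover obtain u where "tight D u" "adj u v" using assms(1) v by (auto simp: locally_minimal_def)
    ultimately show False using tight_neighbour_not_removed[OF alliance_finite[OF all]] v by blast
  qed
  ultimately show ?thesis by (simp add: locally_minimal_defensive_alliance_def)
qed

end

lemma large_graph_has_large_alliance:
  assumes "simple_graph V E" "min_degree_ge 2 V E" "1 \<le> k" "size_bound k (2 * k) \<le> card V"
  shows "\<exists>D. locally_minimal_defensive_alliance V E D \<and> k \<le> card D"
proof -
  interpret min_degree_2_graph V E by unfold_locales fact+
  obtain D where "locally_minimal D" "k \<le> card D" using large_locally_minimal[OF assms(3,4)] by blast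
  moreover from this have "D \<noteq> {}" using assms(3) by auto
  ultimately show ?thesis using locally_minimal_imp by blast
qed

section \<open>Programs\<close>

text \<open>The length of the right spine: the value of a unary number, or the number of vertices
  for an adjacency matrix.\<close>

primrec len :: "tree \<Rightarrow> nat" where
  "len Leaf = 0"
| "len (Node l r) = Suc (len r)"

lemma len_le_size: "len t \<le> size t"
  by (induction t) auto

lemma len_enc_list [simp]: "len (enc_list xs) = length xs"
  by (induction xs) auto

lemma len_enc_nat [simp]: "len (enc_nat n) = n"
  by (induction n) auto

lemma size_enc_nat [simp]: "size (enc_nat n) = n"
  by (induction n) auto

lemma enc_nat_eq_Leaf [simp]: "enc_nat n = Leaf \<longleftrightarrow> n = 0"
  by (cases n) auto

lemma enc_nat_inject [simp]: "enc_nat m = enc_nat n \<longleftrightarrow> m = n"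
  by (metis size_enc_nat)

lemma right_enc_nat [simp]: "right (enc_nat n) = enc_nat (n - 1)"
  by (cases n) auto

lemma size_enc_list: "size (enc_list xs) = length xs + sum_list (map size xs)"
  by (induction xs) auto

section \<open>Loop-free programs as functions\<close>

text \<open>On programs satisfying \<open>loop_free\<close>, \<open>post\<close> and
  \<open>cost\<close> let simplification compute the effect and cost of a loop body.\<close>

primrec post :: "com \<Rightarrow> store \<Rightarrow> store" where
  "post (Assign x a) s = s(x := eval_expr a s)"
| "post (Seq c d) s = post d (post c s)"
| "post (Cond a c d) s = (if eval_expr a s \<noteq> Leaf then post c s else post d s)"
| "post (While a c) s = s"

primrec cost :: "com \<Rightarrow> store \<Rightarrow> nat" where
  "cost (Assign x a) s = 1 + size (eval_expr a s)"
| "cost (Seq c d) s = cost c s + cost d (post c s)"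
| "cost (Cond a c d) s = 1 + (if eval_expr a s \<noteq> Leaf then cost c s else cost d s)"
| "cost (While a c) s = 0"

primrec loop_free :: "com \<Rightarrow> bool" where
  "loop_free (Assign x a) = True"
| "loop_free (Seq c d) = (loop_free c \<and> loop_free d)"
| "loop_free (Cond a c d) = (loop_free c \<and> loop_free d)"
| "loop_free (While a c) = False"

lemma exec_loop_free: "loop_free c \<Longrightarrow> exec c s (cost c s) (post c s)"
proof (induction c arbitrary: s)
  case (Assign x a)
  show ?case unfolding post.simps cost.simps by (rule exec.Assign)
next
  case (Cond a c d)
  then show ?case
    using exec.CondTrue[of a s c "cost c s" "post c s" d] exec.CondFalse[of a s d "cost d s" "post d s" c]
    by auto
qed (auto intro: exec.intros)

lemma exec_WhileTrue_loop_free: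
  assumes "eval_expr a s \<noteq> Leaf" "loop_free c" "exec (While a c) (post c s) t s'"
  shows "exec (While a c) s (1 + cost c s + t) s'"
  using exec.WhileTrue[OF assms(1) exec_loop_free[OF assms(2)] assms(3)] .

text \<open>A doubling process: each tick moves a unit from variable 2 to two units in variable 3, and
  once variable 2 is exhausted, variable 3 plus one more unit is moved back. The \<open>l\<close>-th such reset
  is tick number \<open>2 ^ l - 1\<close>, so counting resets against ticks gives a logarithm, and counting ticks
  against resets gives a power. After \<open>2 ^ l - 1 + q\<close> ticks with \<open>q < 2 ^ l\<close>, variables 2 and 3
  contain \<open>2 ^ l - 1 - q\<close> and \<open>2 * q\<close>.\<close>

definition tick :: "com \<Rightarrow> com" where
  "tick c = Cond (Var 2)
     (Seq (Assign 2 (RightE (Var 2))) (Assign 3 (NodeE LeafE (NodeE LeafE (Var 3)))))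
     (Seq (Assign 2 (NodeE LeafE (Var 3))) (Seq (Assign 3 LeafE) c))"

definition log_body :: com where
  "log_body = Seq (Assign 1 (RightE (Var 1))) (tick (Assign 4 (NodeE LeafE (Var 4))))"

definition log_com :: com where
  "log_com = Seq (While (Var 1) log_body)
     (Seq (Assign 1 (Var 4)) (Seq (Assign 2 LeafE) (Seq (Assign 3 LeafE) (Assign 4 LeafE))))"

definition exp_body :: com where
  "exp_body = Seq (Assign 4 (NodeE LeafE (Var 4))) (tick (Assign 0 (RightE (Var 0))))"

definition exp_com :: com where
  "exp_com = Seq (Assign 4 (NodeE LeafE LeafE)) (Seq (While (Var 0) exp_body)
     (Seq (Assign 0 (Var 4)) (Seq (Assign 2 LeafE) (Seq (Assign 3 LeafE) (Assign 4 LeafE)))))"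

text \<open>A reset at \<open>q = 2 ^ l - 1\<close> puts \<open>2 * q + 1\<close> into variable 2,
  the initial content \<open>2 ^ Suc l - 1\<close> of the next level.\<close>

lemma reset_arith: "Suc (2 * (2 ^ l - Suc 0)) = 2 * 2 ^ l - Suc 0"
  using zero_less_power[of "2 :: nat" l] by arith

section \<open>The logarithm program\<close>

text \<open>A tick raises \<open>2 ^ l + q\<close> by 1 and takes at least one unit off variable 1,
  so \<open>B\<close> remains a bound; \<open>q < 2 ^ l\<close> makes \<open>l\<close> the
  \<open>floor_log\<close> of \<open>2 ^ l + q\<close>.\<close>

lemma exec_log_loop:
  assumes "s 2 = enc_nat (2 ^ l - 1 - q)" "s 3 = enc_nat (2 * q)" "s 4 = enc_nat l" "q < 2 ^ l"
    "size (s 1) + 2 ^ l + q \<le> B"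
  shows "\<exists>t s'. exec (While (Var 1) log_body) s t s' \<and> t \<le> len (s 1) * (5 * B + 10) + 1 \<and>
    s' 4 = enc_nat (floor_log (2 ^ l + q + len (s 1))) \<and> (\<forall>x. x \<notin> {1,2,3,4} \<longrightarrow> s' x = s x)"
  using assms
proof (induction "s 1" arbitrary: s l q)
  case Leaf
  have "floor_log (2 ^ l + q) = l" using Leaf.prems(4) by (intro floor_log_eqI) auto
  moreover have "exec (While (Var 1) log_body) s 1 s" using Leaf.hyps by (intro exec.WhileFalse) simp
  ultimately show ?case using Leaf by (intro exI[of _ 1] exI[of _ s]) (auto simp flip: Leaf.hyps)
next
  case (Node h r)
  let ?s = "post log_body s"
  have s1: "s 1 = Node h r" using Node.hyps by simp
  have lf: "loop_free log_body" by (simp add: log_body_def tick_def)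
  have l: "l \<le> B" using Node.prems(5) less_exp[of l] by linarith
  obtain l' q' where inv: "?s 2 = enc_nat (2 ^ l' - 1 - q')" "?s 3 = enc_nat (2 * q')"
    "?s 4 = enc_nat l'" "q' < 2 ^ l'" "2 ^ l' + q' = 2 ^ l + q + 1"
    and others: "\<forall>x. x \<notin> {1,2,3,4} \<longrightarrow> ?s x = s x" and r: "?s 1 = r"
    and cost: "cost log_body s \<le> 5 * B + 9"
  proof (cases "2 ^ l - 1 - q = 0")
    case True
    then have q: "q = 2 ^ l - 1" using Node.prems(4) by simp
    have "cost log_body s \<le> 5 * B + 9" "?s 1 = r"
      using True Node.prems s1 l by (auto simp: log_body_def tick_def)
    then show ?thesis using that[of "Suc l" 0] True Node.prems s1 q
      by (auto simp: log_body_def tick_def reset_arith simp flip: enc_nat.simps(2))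
  next
    case False
    have "cost log_body s \<le> 5 * B + 9" "?s 1 = r"
      using False Node.prems s1 by (auto simp: log_body_def tick_def)
    then show ?thesis using that[of l "Suc q"] False Node.prems s1
      by (auto simp: log_body_def tick_def simp flip: enc_nat.simps(2))
  qed
  have "size (?s 1) + 2 ^ l' + q' \<le> B" using inv(5) r s1 Node.prems(5) by simp
  from Node.hyps(2)[OF r[symmetric] inv(1-4) this] r obtain t s' where
    t: "exec (While (Var 1) log_body) ?s t s'" "t \<le> len r * (5 * B + 10) + 1"
      "s' 4 = enc_nat (floor_log (2 ^ l' + q' + len r))" "\<forall>x. x \<notin> {1,2,3,4} \<longrightarrow> s' x = ?s x"
    by auto
  have "exec (While (Var 1) log_body) s (1 + cost log_body s + t) s'"
    using exec_WhileTrue_loop_free[OF _ lf t(1)] s1 by simp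
  moreover have "1 + cost log_body s + t \<le> len (s 1) * (5 * B + 10) + 1"
    using t(2) cost s1 by simp
  moreover have "s' 4 = enc_nat (floor_log (2 ^ l + q + len (s 1)))"
    using t(3) inv(5) s1 by simp
  ultimately show ?case using t(4) others by auto
qed

lemma exec_log_com:
  assumes "s 2 = Leaf" "s 3 = Leaf" "s 4 = Leaf" "size (s 1) \<le> B"
  shows "\<exists>t \<le> 20 * (B + 1)\<^sup>2. exec log_com s t (s(1 := enc_nat (floor_log (Suc (len (s 1))))))"
proof -
  let ?c = "Seq (Assign 1 (Var 4)) (Seq (Assign 2 LeafE) (Seq (Assign 3 LeafE) (Assign 4 LeafE)))"
  let ?l = "floor_log (Suc (len (s 1)))"
  \<comment> \<open>Empty variables are the state \<open>l = q = 0\<close>, where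
    \<open>2 ^ l + q = 1\<close>; hence the \<open>Suc\<close>.\<close>
  obtain t s' where t: "exec (While (Var 1) log_body) s t s'" "t \<le> len (s 1) * (5 * (B + 1) + 10) + 1"
    "s' 4 = enc_nat ?l" "\<forall>x. x \<notin> {1,2,3,4} \<longrightarrow> s' x = s x"
    using exec_log_loop[of s 0 0 "B + 1"] assms by auto
  have "2 ^ ?l \<le> Suc (len (s 1))" by (rule floor_log_exp2_le) simp
  then have "?l \<le> len (s 1)" using less_exp[of ?l] by linarith
  moreover have len: "len (s 1) \<le> B" using assms(4) len_le_size[of "s 1"] by simp
  ultimately have c: "cost ?c s' \<le> B + 4" using t(3) by simp
  have "t \<le> B * (5 * (B + 1) + 10) + 1"
    using t(2) mult_le_mono1[OF len, of "5 * (B + 1) + 10"] by linarith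
  then have "t + cost ?c s' \<le> 20 * (B + 1)\<^sup>2"
    using c by (simp add: power2_eq_square algebra_simps)
  moreover have "post ?c s' = s(1 := enc_nat ?l)"
    using t(3,4) assms by (auto simp: fun_eq_iff)
  then have "exec log_com s (t + cost ?c s') (s(1 := enc_nat ?l))"
    unfolding log_com_def using exec.Seq[OF t(1) exec_loop_free[of ?c s']] by simp
  ultimately show ?thesis by blast
qed

section \<open>The exponential program\<close>

text \<open>A reset lowers \<open>r\<close>, any other tick lowers variable 2, whence the
  lexicographic induction. Since \<open>r\<close> decreases only at a reset, \<open>q = 0\<close>
  when the loop ends and variable 4 holds a power of 2. No time bound is kept, as
  \<open>computable\<close> asks for none.\<close>

lemma exec_exp_loop:
  assumes "s 0 = enc_nat r" "s 2 = enc_nat (2 ^ l - 1 - q)" "s 3 = enc_nat (2 * q)"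
    "s 4 = enc_nat (2 ^ l + q)" "q < 2 ^ l" "r = 0 \<Longrightarrow> q = 0"
  shows "\<exists>t s'. exec (While (Var 0) exp_body) s t s' \<and> s' 4 = enc_nat (2 ^ (l + r)) \<and>
    (\<forall>x. x \<notin> {0,2,3,4} \<longrightarrow> s' x = s x)"
  using assms
proof (induction "(r, 2 ^ l - 1 - q)" arbitrary: s r l q
    rule: wf_induct_rule[OF wf_lex_prod[OF wf_less_than wf_less_than]])
  case 1
  note IH = 1(1) and prems = 1(2-)
  have lf: "loop_free exp_body" by (simp add: exp_body_def tick_def)
  let ?s = "post exp_body s"
  show ?case
  proof (cases "r = 0")
    case True
    then show ?thesis using prems exec.WhileFalse[of "Var 0" s exp_body]
      by (intro exI[of _ 1] exI[of _ s]) auto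
  next
    case r: False
    have "\<exists>t s'. exec (While (Var 0) exp_body) ?s t s' \<and> s' 4 = enc_nat (2 ^ (l + r)) \<and>
      (\<forall>x. x \<notin> {0,2,3,4} \<longrightarrow> s' x = s x)"
    proof (cases "2 ^ l - 1 - q = 0")
      case True
      then have q: "q = 2 ^ l - 1" using prems(5) by simp
      have "\<exists>t s'. exec (While (Var 0) exp_body) ?s t s' \<and> s' 4 = enc_nat (2 ^ (Suc l + (r - 1))) \<and>
        (\<forall>x. x \<notin> {0,2,3,4} \<longrightarrow> s' x = ?s x)"
        using True prems q r
        by (intro IH[of "r - 1" "Suc l" 0]) (auto simp: exp_body_def tick_def reset_arith simp flip: enc_nat.simps(2))
      moreover have "\<forall>x. x \<notin> {0,2,3,4} \<longrightarrow> ?s x = s x" by (auto simp: exp_body_def tick_def)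
      ultimately show ?thesis using r by auto
    next
      case False
      have "\<exists>t s'. exec (While (Var 0) exp_body) ?s t s' \<and> s' 4 = enc_nat (2 ^ (l + r)) \<and>
        (\<forall>x. x \<notin> {0,2,3,4} \<longrightarrow> s' x = ?s x)"
        using False prems r
        by (intro IH[of r l "Suc q"]) (auto simp: exp_body_def tick_def simp flip: enc_nat.simps(2))
      moreover have "\<forall>x. x \<notin> {0,2,3,4} \<longrightarrow> ?s x = s x" by (auto simp: exp_body_def tick_def)
      ultimately show ?thesis by auto
    qed
    then obtain t s' where t: "exec (While (Var 0) exp_body) ?s t s'"
      "s' 4 = enc_nat (2 ^ (l + r))" "\<forall>x. x \<notin> {0,2,3,4} \<longrightarrow> s' x = s x" by blast
    have "eval_expr (Var 0) s \<noteq> Leaf" using prems(1) r by simp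
    from exec_WhileTrue_loop_free[OF this lf t(1)] t(2,3) show ?thesis by blast
  qed
qed

lemma exec_exp_com:
  assumes "s 2 = Leaf" "s 3 = Leaf" "s 4 = Leaf" "s 0 = enc_nat n"
  shows "\<exists>t. exec exp_com s t (s(0 := enc_nat (2 ^ n)))"
proof -
  let ?i = "Assign 4 (NodeE LeafE LeafE)"
  let ?c = "Seq (Assign 0 (Var 4)) (Seq (Assign 2 LeafE) (Seq (Assign 3 LeafE) (Assign 4 LeafE)))"
  obtain t s' where t: "exec (While (Var 0) exp_body) (post ?i s) t s'"
    "s' 4 = enc_nat (2 ^ n)" "\<forall>x. x \<notin> {0,2,3,4} \<longrightarrow> s' x = s x"
    using exec_exp_loop[of "post ?i s" n 0 0] assms by auto
  have "post ?c s' = s(0 := enc_nat (2 ^ n))" using t(2,3) assms by (auto simp: fun_eq_iff)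
  then have "exec exp_com s (cost ?i s + (t + cost ?c s')) (s(0 := enc_nat (2 ^ n)))"
    unfolding exp_com_def
    using exec.Seq[OF exec_loop_free[of ?i s] exec.Seq[OF t(1) exec_loop_free[of ?c s']]] by simp
  then show ?thesis by blast
qed

primrec plus_expr :: "nat \<Rightarrow> expr \<Rightarrow> expr" where
  "plus_expr 0 a = a"
| "plus_expr (Suc n) a = NodeE LeafE (plus_expr n a)"

lemma eval_plus_expr: "eval_expr a s = enc_nat k \<Longrightarrow> eval_expr (plus_expr n a) s = enc_nat (k + n)"
  by (induction n) auto

text \<open>High enough to dominate \<open>size_bound k (2 * k)\<close>, yet comparable with the
  number of vertices by taking three logarithms of the latter.\<close>

definition exp3 :: "nat \<Rightarrow> nat" where
  "exp3 n = 2 ^ 2 ^ 2 ^ n"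

lemma computable_exp3: "computable (\<lambda>k. exp3 (k + c))"
  unfolding computable_def
proof (intro exI[of _ "Seq (Assign 0 (plus_expr c (Var 0))) (Seq exp_com (Seq exp_com exp_com))"] allI)
  fix k
  define S :: "tree \<Rightarrow> store" where "S x = (\<lambda>_. Leaf)(0 := x)" for x
  have e: "\<exists>t. exec exp_com (S (enc_nat m)) t (S (enc_nat (2 ^ m)))" for m
    using exec_exp_com[of "S (enc_nat m)" m] by (simp add: S_def)
  obtain t1 t2 t3 where "exec exp_com (S (enc_nat (k + c))) t1 (S (enc_nat (2 ^ (k + c))))"
    "exec exp_com (S (enc_nat (2 ^ (k + c)))) t2 (S (enc_nat (2 ^ 2 ^ (k + c))))"
    "exec exp_com (S (enc_nat (2 ^ 2 ^ (k + c)))) t3 (S (enc_nat (exp3 (k + c))))"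
    using e unfolding exp3_def by metis
  moreover have "post (Assign 0 (plus_expr c (Var 0))) (S (enc_nat k)) = S (enc_nat (k + c))"
    by (auto simp: S_def eval_plus_expr)
  ultimately have "\<exists>t. exec (Seq (Assign 0 (plus_expr c (Var 0))) (Seq exp_com (Seq exp_com exp_com)))
      (S (enc_nat k)) t (S (enc_nat (exp3 (k + c))))"
    using exec.Seq exec_loop_free[of "Assign 0 (plus_expr c (Var 0))" "S (enc_nat k)"]
    by (metis loop_free.simps(1))
  then show "\<exists>t. runs (Seq (Assign 0 (plus_expr c (Var 0))) (Seq exp_com (Seq exp_com exp_com)))
      (enc_nat k) t (enc_nat (exp3 (k + c)))"
    unfolding runs_def S_def by (metis fun_upd_same)
qed

section \<open>Truncated subtraction\<close>

definition sub_body :: com where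
  "sub_body = Seq (Assign 1 (RightE (Var 1))) (Assign 2 (RightE (Var 2)))"

text \<open>Truncation comes from \<open>right Leaf = Leaf\<close>.\<close>

lemma exec_sub_loop:
  assumes "s 1 = enc_nat p" "s 2 = enc_nat q" "p + q \<le> B"
  shows "\<exists>t \<le> q * (B + 3) + 1. exec (While (Var 2) sub_body) s t (s(1 := enc_nat (p - q), 2 := Leaf))"
  using assms
proof (induction q arbitrary: s p)
  case 0
  then have s: "s(1 := enc_nat (p - 0), 2 := Leaf) = s" by (auto simp: fun_eq_iff)
  have "exec (While (Var 2) sub_body) s 1 s" using 0 by (intro exec.WhileFalse) simp
  then show ?case unfolding s by (intro exI[of _ 1]) simp
next
  case (Suc q)
  have lf: "loop_free sub_body" by (simp add: sub_body_def)
  have p: "post sub_body s = s(1 := enc_nat (p - 1), 2 := enc_nat q)"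
    using Suc.prems by (simp add: sub_body_def)
  have c: "cost sub_body s \<le> B + 2" using Suc.prems by (simp add: sub_body_def)
  have "post sub_body s 1 = enc_nat (p - 1)" "post sub_body s 2 = enc_nat q" "p - 1 + q \<le> B"
    using p Suc.prems by auto
  from Suc.IH[OF this] obtain t where t: "t \<le> q * (B + 3) + 1" "exec (While (Var 2) sub_body)
      (post sub_body s) t ((post sub_body s)(1 := enc_nat (p - 1 - q), 2 := Leaf))"
    by blast
  have "(post sub_body s)(1 := enc_nat (p - 1 - q), 2 := Leaf) = s(1 := enc_nat (p - Suc q), 2 := Leaf)"
    unfolding p by (auto simp: fun_eq_iff)
  then have "exec (While (Var 2) sub_body) s (1 + cost sub_body s + t) (s(1 := enc_nat (p - Suc q), 2 := Leaf))"
    using exec_WhileTrue_loop_free[OF _ lf t(2)] Suc.prems by simp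
  moreover have "1 + cost sub_body s + t \<le> Suc q * (B + 3) + 1" using c t(1) by simp
  ultimately show ?case by blast
qed

primrec const_expr :: "tree \<Rightarrow> expr" where
  "const_expr Leaf = LeafE"
| "const_expr (Node l r) = NodeE (const_expr l) (const_expr r)"

lemma eval_const_expr [simp]: "eval_expr (const_expr t) s = t"
  by (induction t) auto

section \<open>The kernel\<close>

abbreviation log1 :: "nat \<Rightarrow> nat" where
  "log1 n \<equiv> floor_log (Suc n)"

section \<open>Iterated logarithms and the size bound\<close>

lemma exp2_log1: "2 ^ log1 n \<le> Suc n"
  by (rule floor_log_exp2_le) simp

lemma log1_le: "log1 n \<le> n"
  using exp2_log1[of n] less_exp[of "log1 n"] by linarith

lemma le_of_Suc_le_log1: "Suc j \<le> log1 n \<Longrightarrow> 2 ^ j \<le> n"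
proof -
  assume "Suc j \<le> log1 n"
  then have "2 ^ Suc j \<le> (2::nat) ^ log1 n" by (intro power_increasing) auto
  then show ?thesis using exp2_log1[of n] zero_less_power[of "2 :: nat" j] by simp
qed

lemma less_of_log1_less: "log1 n < j \<Longrightarrow> n < 2 ^ j"
proof -
  assume "log1 n < j"
  then have "2 ^ Suc (log1 n) \<le> (2::nat) ^ j" by (intro power_increasing) auto
  then show ?thesis using floor_log_exp2_gt[of "Suc n"] by simp
qed

text \<open>Each of the three inversions of \<open>log1\<close> loses 1, which turns
  \<open>k + 7\<close> into \<open>k + 4\<close>.\<close>

lemma exp3_le_of_log1:
  assumes "k + 7 \<le> log1 (log1 (log1 n))"
  shows "exp3 (k + 4) \<le> n"
proof -
  have pow: "Suc (2 ^ a) \<le> (2::nat) ^ Suc a" for a using zero_less_power[of "2 :: nat" a] by simp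
  have "2 ^ (k + 6) \<le> log1 (log1 n)" using le_of_Suc_le_log1[of "k + 6"] assms by simp
  then have "Suc (2 ^ (k + 5)) \<le> log1 (log1 n)" using pow[of "k + 5"] by (simp add: add.commute)
  then have a: "2 ^ 2 ^ (k + 5) \<le> log1 n" by (rule le_of_Suc_le_log1)
  have "Suc (2 ^ (k + 4)) \<le> 2 ^ (k + 5)" using pow[of "k + 4"] by (simp add: add.commute)
  then have "(2::nat) ^ Suc (2 ^ (k + 4)) \<le> 2 ^ 2 ^ (k + 5)" by (rule power_increasing) simp
  then have "Suc (2 ^ 2 ^ (k + 4)) \<le> log1 n" using a pow[of "2 ^ (k + 4)"] by linarith
  then show ?thesis unfolding exp3_def by (rule le_of_Suc_le_log1)
qed

lemma less_exp3_of_log1: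
  assumes "log1 (log1 (log1 n)) < k"
  shows "n < exp3 k"
  using assms less_of_log1_less unfolding exp3_def by metis

text \<open>The recursion reads \<open>64 * k * size_bound k j ^ 6\<close>, and
  \<open>6 * 7 ^ j + 1 \<le> 7 ^ Suc j\<close> absorbs the factor.\<close>

lemma size_bound_le: "1 \<le> k \<Longrightarrow> size_bound k j \<le> (64 * k) ^ 7 ^ j"
proof (induction j)
  case (Suc j)
  let ?a = "64 * k"
  have "size_bound k (Suc j) = ?a * size_bound k j ^ 6" by (simp add: power_mult_distrib)
  also have "\<dots> \<le> ?a * (?a ^ 7 ^ j) ^ 6" using Suc by (intro mult_le_mono2 power_mono) auto
  also have "\<dots> = ?a ^ Suc (6 * 7 ^ j)" unfolding power_Suc power_mult[symmetric] mult.commute[of 6] ..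
  also have "\<dots> \<le> ?a ^ 7 ^ Suc j" using Suc.prems zero_less_power[of "7 :: nat" j]
    by (intro power_increasing) auto
  finally show ?case .
qed simp

lemma size_bound_le_exp3:
  assumes "1 \<le> k"
  shows "size_bound k (2 * k) \<le> exp3 (k + 4)"
proof -
  have k: "k \<le> 2 ^ k" using less_exp[of k] by simp
  have "64 * k \<le> 2 ^ (k + 6)" using k by (simp add: power_add)
  \<comment> \<open>Because \<open>7 ^ 2 = 49 \<le> 64 = 2 ^ 6\<close>.\<close>
  moreover have "(7::nat) ^ (2 * k) \<le> 2 ^ (6 * k)"
    unfolding power_mult by (intro power_mono) auto
  ultimately have "(64 * k) ^ 7 ^ (2 * k) \<le> (2 ^ (k + 6)) ^ 2 ^ (6 * k)"
    using assms by (intro order_trans[OF power_increasing[of _ "2 ^ (6 * k)"] power_mono]) linarith+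
  also have "\<dots> = 2 ^ ((k + 6) * 2 ^ (6 * k))" by (rule power_mult[symmetric])
  also have "\<dots> \<le> 2 ^ (2 ^ (k + 6) * 2 ^ (6 * k))"
    using less_exp[of "k + 6"] by (intro power_increasing mult_le_mono1) auto
  also have "\<dots> = 2 ^ 2 ^ (7 * k + 6)" by (simp flip: power_add)
  also have "\<dots> \<le> exp3 (k + 4)" unfolding exp3_def
  proof (intro power_increasing)
    have "k + 1 \<le> 2 ^ k" using less_exp[of k] by linarith
    then show "7 * k + 6 \<le> 2 ^ (k + 4)" by (simp add: power_add)
  qed auto
  finally show ?thesis using size_bound_le[OF assms, of "2 * k"] by simp
qed

section \<open>The kernel program\<close>

text \<open>Variable 1 starts as the adjacency matrix, whose \<open>len\<close> is \<open>n\<close>.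
  Truncated subtraction of \<open>k + 6\<close> leaves a true value exactly if
  \<open>k + 7 \<le> log1 (log1 (log1 n))\<close>.\<close>

definition kernel_com :: "tree \<Rightarrow> com" where
  "kernel_com y = Seq (Assign 1 (LeftE (Var 0))) (Seq log_com (Seq log_com (Seq log_com
     (Seq (Assign 2 (plus_expr 6 (RightE (Var 0)))) (Seq (While (Var 2) sub_body)
     (Cond (Var 1) (Assign 0 (const_expr y)) (Assign 0 (Var 0))))))))"

lemma runs_kernel_com:
  fixes M y :: tree and k :: nat
  defines "x \<equiv> Node M (enc_nat k)"
  shows "\<exists>t \<le> 200 * (size x + 1)\<^sup>2 + size y.
    runs (kernel_com y) x t (if k + 7 \<le> log1 (log1 (log1 (len M))) then y else x)"
proof -
  let ?B = "size x" and ?n = "len M"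
  define S :: "tree \<Rightarrow> tree \<Rightarrow> store" where "S a b = (\<lambda>_. Leaf)(0 := x, 1 := a, 2 := b)" for a b
  have B: "size M \<le> ?B" "k \<le> ?B" "?n \<le> ?B" using len_le_size[of M] by (auto simp: x_def)
  have log: "\<exists>t \<le> 20 * (?B + 1)\<^sup>2. exec log_com (S a Leaf) t (S (enc_nat (log1 (len a))) Leaf)"
    if "size a \<le> ?B" for a
  proof -
    have "(S a Leaf)(1 := enc_nat (log1 (len a))) = S (enc_nat (log1 (len a))) Leaf"
      by (auto simp: S_def fun_eq_iff)
    then show ?thesis using exec_log_com[of "S a Leaf" ?B] that by (simp add: S_def)
  qed
  let ?l1 = "log1 ?n" and ?l2 = "log1 (log1 ?n)" and ?l3 = "log1 (log1 (log1 ?n))"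
  have l: "?l1 \<le> ?B" "?l2 \<le> ?B" "?l3 \<le> ?B"
    using log1_le[of ?n] log1_le[of ?l1] log1_le[of ?l2] B by linarith+
  obtain t1 where t1: "t1 \<le> 20 * (?B + 1)\<^sup>2" "exec log_com (S M Leaf) t1 (S (enc_nat ?l1) Leaf)"
    using log[OF B(1)] by blast
  obtain t2 where t2: "t2 \<le> 20 * (?B + 1)\<^sup>2"
    "exec log_com (S (enc_nat ?l1) Leaf) t2 (S (enc_nat ?l2) Leaf)"
    using log[of "enc_nat ?l1"] l by auto
  obtain t3 where t3: "t3 \<le> 20 * (?B + 1)\<^sup>2"
    "exec log_com (S (enc_nat ?l2) Leaf) t3 (S (enc_nat ?l3) Leaf)"
    using log[of "enc_nat ?l2"] l by auto
  have "exec (Assign 1 (LeftE (Var 0))) ((\<lambda>_. Leaf)(0 := x)) (1 + size M)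
    (((\<lambda>_. Leaf)(0 := x))(1 := M))"
    using exec.Assign[of 1 "LeftE (Var 0)" "(\<lambda>_. Leaf)(0 := x)"] by (simp add: x_def)
  moreover have "((\<lambda>_. Leaf)(0 := x))(1 := M) = S M Leaf" by (auto simp: S_def fun_eq_iff)
  ultimately have a1: "exec (Assign 1 (LeftE (Var 0))) ((\<lambda>_. Leaf)(0 := x)) (1 + size M) (S M Leaf)"
    by simp
  have e: "eval_expr (plus_expr 6 (RightE (Var 0))) (S (enc_nat ?l3) Leaf) = enc_nat (k + 6)"
    by (rule eval_plus_expr) (simp add: S_def x_def)
  have "(S (enc_nat ?l3) Leaf)(2 := enc_nat (k + 6)) = S (enc_nat ?l3) (enc_nat (k + 6))"
    by (simp add: S_def)
  then have a2: "exec (Assign 2 (plus_expr 6 (RightE (Var 0)))) (S (enc_nat ?l3) Leaf) (1 + (k + 6))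
    (S (enc_nat ?l3) (enc_nat (k + 6)))"
    using exec.Assign[of 2 "plus_expr 6 (RightE (Var 0))" "S (enc_nat ?l3) Leaf"] unfolding e by simp
  have "(S (enc_nat ?l3) (enc_nat (k + 6)))(1 := enc_nat (?l3 - (k + 6)), 2 := Leaf) =
    S (enc_nat (?l3 - (k + 6))) Leaf" by (auto simp: S_def fun_eq_iff)
  moreover have "S (enc_nat ?l3) (enc_nat (k + 6)) 1 = enc_nat ?l3"
      "S (enc_nat ?l3) (enc_nat (k + 6)) 2 = enc_nat (k + 6)" by (auto simp: S_def)
  ultimately obtain t4 where t4: "t4 \<le> (k + 6) * ((?l3 + (k + 6)) + 3) + 1"
    "exec (While (Var 2) sub_body) (S (enc_nat ?l3) (enc_nat (k + 6))) t4 (S (enc_nat (?l3 - (k + 6))) Leaf)"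
    using exec_sub_loop[of "S (enc_nat ?l3) (enc_nat (k + 6))" ?l3 "k + 6", OF _ _ order_refl] by metis
  let ?c = "Cond (Var 1) (Assign 0 (const_expr y)) (Assign 0 (Var 0))"
  let ?s = "S (enc_nat (?l3 - (k + 6))) Leaf"
  have a5: "exec ?c ?s (cost ?c ?s) (post ?c ?s)" by (rule exec_loop_free) simp
  have res: "post ?c ?s 0 = (if k + 7 \<le> ?l3 then y else x)"
    by (auto simp: S_def)
  have c5: "cost ?c ?s \<le> 2 + size y + ?B" by (auto simp: S_def)
  let ?t = "1 + size M + (t1 + (t2 + (t3 + (1 + (k + 6) + (t4 + cost ?c ?s)))))"
  have "exec (kernel_com y) ((\<lambda>_. Leaf)(0 := x)) ?t (post ?c ?s)"
    unfolding kernel_com_def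
    by (rule exec.Seq[OF a1 exec.Seq[OF t1(2) exec.Seq[OF t2(2) exec.Seq[OF t3(2)
        exec.Seq[OF a2 exec.Seq[OF t4(2) a5]]]]]])
  then have "runs (kernel_com y) x ?t (if k + 7 \<le> ?l3 then y else x)"
    unfolding runs_def using res by blast
  moreover have "t4 \<le> (?B + 6) * (2 * ?B + 9) + 1"
    using mult_le_mono[of "k + 6" "?B + 6" "(?l3 + (k + 6)) + 3" "2 * ?B + 9"] t4(1) B l by linarith
  then have "?t \<le> 200 * (?B + 1)\<^sup>2 + size y"
    using t1(1) t2(1) t3(1) c5 B by (simp add: power2_eq_square algebra_simps)
  ultimately show ?thesis by blast
qed

section \<open>Equivalence, running time and size of the kernel\<close>

text \<open>A fixed yes-instance; its parameter is 1 because instances have positive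
  parameters.\<close>

definition triangle :: lmda_instance where
  "triangle = (3, {{0, 1}, {0, 2}, {1, 2}}, 1)"

definition kernel :: "lmda_instance \<Rightarrow> lmda_instance" where
  "kernel = (\<lambda>(n, E, k). if k + 7 \<le> log1 (log1 (log1 n)) then triangle else (n, E, k))"

lemma triangle_instance: "triangle \<in> lmda_instances_min_degree_2"
proof -
  let ?E = "{{0, 1}, {0, 2}, {1, 2}} :: nat set set"
  have "simple_graph {..<3} ?E" by (auto simp: simple_graph_def)
  moreover have "2 \<le> deg_in ?E {..<3} v" if v: "v < 3" for v
  proof -
    consider "v = 0" | "v = 1" | "v = 2" using v by linarith
    then have "{u. u < 3 \<and> u \<noteq> v} \<subseteq> {u \<in> {..<3}. {u, v} \<in> ?E}"
      by cases (auto simp: doubleton_eq_iff)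
    then have "card {u. u < 3 \<and> u \<noteq> v} \<le> deg_in ?E {..<3} v"
      unfolding deg_in_def by (intro card_mono) auto
    moreover have "{u. u < 3 \<and> u \<noteq> v} = {..<3} - {v}" by auto
    ultimately show ?thesis using v by simp
  qed
  ultimately show ?thesis
    by (simp add: triangle_def lmda_instances_min_degree_2_def min_degree_ge_def)
qed

text \<open>Removals never empty an alliance, so the whole vertex set shrinks to a nonempty locally
  minimal one.\<close>

lemma yes_of_parameter_1:
  assumes "(n, E, 1) \<in> lmda_instances_min_degree_2" "0 < n"
  shows "(n, E, 1) \<in> lmda_yes_instances_min_degree_2"
proof -
  interpret min_degree_2_graph "{..<n}" E
    using assms(1) by unfold_locales (auto simp: lmda_instances_min_degree_2_def)
  obtain D where D: "reach UNIV {..<n} D" "locally_minimal D"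
    using reach_locally_minimal[OF alliance_V] .
  then have ne: "D \<noteq> {}" using reach_nonempty[OF D(1) alliance_V] assms(2) by blast
  moreover have "finite D" using D(2) alliance_finite by (auto simp: locally_minimal_def)
  ultimately have "1 \<le> card D" by (simp add: Suc_le_eq card_gt_0_iff)
  then show ?thesis using locally_minimal_imp[OF D(2) ne] assms(1)
    by (auto simp: lmda_yes_instances_min_degree_2_def)
qed

lemma large_instance_yes:
  assumes "(n, E, k) \<in> lmda_instances_min_degree_2" "k + 7 \<le> log1 (log1 (log1 n))"
  shows "(n, E, k) \<in> lmda_yes_instances_min_degree_2"
proof -
  have k: "1 \<le> k" and g: "simple_graph {..<n} E" "min_degree_ge 2 {..<n} E"
    using assms(1) by (auto simp: lmda_instances_min_degree_2_def)
  have "size_bound k (2 * k) \<le> card {..<n}"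
    using exp3_le_of_log1[OF assms(2)] size_bound_le_exp3[OF k] by simp
  from large_graph_has_large_alliance[OF g k this] show ?thesis
    using assms(1) by (auto simp: lmda_yes_instances_min_degree_2_def)
qed

lemma kernel_equiv:
  assumes "x \<in> lmda_instances_min_degree_2"
  shows "kernel x \<in> lmda_instances_min_degree_2 \<and>
    (kernel x \<in> lmda_yes_instances_min_degree_2 \<longleftrightarrow> x \<in> lmda_yes_instances_min_degree_2)"
proof -
  obtain n E k where x: "x = (n, E, k)" by (cases x)
  have "triangle \<in> lmda_yes_instances_min_degree_2"
    using triangle_instance yes_of_parameter_1[of 3] by (simp add: triangle_def)
  then show ?thesis
    using assms large_instance_yes[of n E k] triangle_instance unfolding x kernel_def by auto
qed

lemma polytime_kernel: "polytime_computable_on I enc_instance kernel"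
  unfolding polytime_computable_on_def
proof (intro exI[of _ "kernel_com (enc_instance triangle)"]
    exI[of _ "[:200 + size (enc_instance triangle), 400, 200:]"] ballI)
  fix x :: lmda_instance
  let ?y = "enc_instance triangle"
  obtain n E k where x: "x = (n, E, k)" by (cases x)
  define M where "M = enc_list (map (\<lambda>i. enc_list (map (\<lambda>j. enc_bool ({i, j} \<in> E)) [0..<n])) [0..<n])"
  have ex: "enc_instance x = Node M (enc_nat k)" by (simp add: x enc_instance_def M_def)
  have "len M = n" by (simp add: M_def)
  then have "enc_instance (kernel x) =
      (if k + 7 \<le> log1 (log1 (log1 (len M))) then ?y else Node M (enc_nat k))"
    using ex by (simp add: x kernel_def)
  moreover have "poly [:200 + size ?y, 400, 200:] m = 200 * (m + 1)\<^sup>2 + size ?y" for m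
    by (simp add: power2_eq_square algebra_simps)
  ultimately show "\<exists>t \<le> poly [:200 + size ?y, 400, 200:] (size (enc_instance x)).
      runs (kernel_com ?y) (enc_instance x) t (enc_instance (kernel x))"
    using runs_kernel_com[of M k ?y] unfolding ex by (simp only:)
qed

text \<open>A row consists of \<open>n\<close> list nodes and \<open>n\<close> entries of size at
  most 1.\<close>

lemma size_enc_instance: "size (enc_instance (n, E, k)) \<le> n * (2 * n) + n + k + 1"
proof -
  have row: "size (enc_list (map (\<lambda>j. enc_bool ({i, j} \<in> E)) [0..<n])) \<le> 2 * n" for i
  proof -
    have "sum_list (map (\<lambda>j. size (enc_bool ({i, j} \<in> E))) [0..<n]) \<le> sum_list (map (\<lambda>j. 1) [0..<n])"
      by (intro sum_list_mono) (simp add: enc_bool_def)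
    then show ?thesis by (simp add: size_enc_list comp_def sum_list_triv)
  qed
  have "sum_list (map (\<lambda>i. size (enc_list (map (\<lambda>j. enc_bool ({i, j} \<in> E)) [0..<n]))) [0..<n]) \<le>
      sum_list (map (\<lambda>i. 2 * n) [0..<n])"
    by (intro sum_list_mono row)
  then show ?thesis by (simp add: enc_instance_def size_enc_list[of "map _ _"] comp_def sum_list_triv)
qed

text \<open>With \<open>a = 2 ^ 2 ^ m\<close>, squaring \<open>exp3 m = 2 ^ a\<close> only doubles
  the exponent, whereas \<open>exp3 (m + 2) = 2 ^ (a ^ 4)\<close>.\<close>

lemma exp3_growth: "3 * (exp3 m)\<^sup>2 + 2 * m + 1 \<le> exp3 (m + 2)"
proof -
  define a :: nat where "a = 2 ^ 2 ^ m"
  have m: "m < 2 ^ m" "(2::nat) ^ m < a" "a < exp3 m" by (simp_all add: a_def exp3_def less_exp)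
  then have e: "2 * m + 1 \<le> 5 * (exp3 m)\<^sup>2" "2 \<le> a"
    using self_le_power[of "exp3 m" 2] by linarith+
  have "exp3 (m + 2) = 2 ^ (a ^ 4)"
    unfolding exp3_def a_def power_mult[symmetric] power_add by simp
  moreover have "2 * a + 3 \<le> a ^ 4"
  proof -
    have "8 * a \<le> a ^ 3 * a" using power_mono[OF e(2), of 3] by (intro mult_le_mono1) simp
    also have "\<dots> = a ^ 4" by (simp add: numeral_eq_Suc)
    finally show ?thesis using e(2) by linarith
  qed
  then have "2 ^ (2 * a + 3) \<le> (2::nat) ^ (a ^ 4)" by (intro power_increasing) auto
  moreover have "(2::nat) ^ (2 * a + 3) = 8 * (exp3 m)\<^sup>2"
    unfolding exp3_def a_def[symmetric] power_mult[symmetric] power_add by simp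
  ultimately show ?thesis using e(1) by linarith
qed

text \<open>An instance that is kept failed the test and so has fewer than
  \<open>exp3 (k + 7)\<close> vertices. Its encoding is quadratic in this number up to a term linear
  in \<open>k\<close>, which \<open>exp3_growth\<close> absorbs.\<close>

lemma kernel_size:
  assumes "x \<in> lmda_instances_min_degree_2"
  shows "size (enc_instance (kernel x)) + parameter (kernel x) \<le> exp3 (parameter x + 9)"
    and "num_vertices (kernel x) \<le> exp3 (parameter x + 9)"
proof -
  obtain n E k where x: "x = (n, E, k)" by (cases x)
  let ?N = "exp3 (k + 7)"
  have "k + 7 < 2 ^ (k + 7)" "2 ^ (k + 7) < (2::nat) ^ 2 ^ (k + 7)" "2 ^ 2 ^ (k + 7) < ?N"
    by (simp_all add: exp3_def less_exp)
  then have N: "3 \<le> ?N" by linarith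
  have "\<exists>n' E' k'. kernel x = (n', E', k') \<and> n' \<le> ?N \<and> k' \<le> k + 7"
    using less_exp3_of_log1[of n "k + 7"] N by (auto simp: x kernel_def triangle_def not_le)
  then obtain n' E' k' where y: "kernel x = (n', E', k')" "n' \<le> ?N" "k' \<le> k + 7" by blast
  have g: "3 * ?N\<^sup>2 + 2 * (k + 7) + 1 \<le> exp3 (k + 9)" using exp3_growth[of "k + 7"] by (simp add: add.commute)
  have "n' * (2 * n') \<le> 2 * ?N\<^sup>2" using mult_le_mono[OF y(2) y(2)] by (simp add: power2_eq_square)
  moreover have N2: "?N \<le> ?N\<^sup>2" using N self_le_power[of ?N 2] by simp
  ultimately show "size (enc_instance (kernel x)) + parameter (kernel x) \<le> exp3 (parameter x + 9)"
    using size_enc_instance[of n' E' k'] y g by (simp add: x parameter_def)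
  show "num_vertices (kernel x) \<le> exp3 (parameter x + 9)"
    using y g N2 by (simp add: x parameter_def num_vertices_def)
qed

theorem theorem4:
  "\<exists>f :: nat \<Rightarrow> nat. computable f \<and>
     (\<exists>K. kernelization lmda_instances_min_degree_2 lmda_yes_instances_min_degree_2
            enc_instance parameter K \<and>
          (\<forall>x \<in> lmda_instances_min_degree_2.
             num_vertices (K x) \<le> f (parameter x) ^ (2 * (parameter x)\<^sup>2 + 4 * parameter x)))"
\<comment> \<open>One function serves both as \<open>f\<close> and as the bound \<open>g\<close> on
  the encoded kernel.\<close>
proof (intro exI[of _ "\<lambda>k. exp3 (k + 9)"] exI[of _ kernel] conjI ballI)
  show "computable (\<lambda>k. exp3 (k + 9))" by (rule computable_exp3)
  then show "kernelization lmda_instances_min_degree_2 lmda_yes_instances_min_degree_2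
      enc_instance parameter kernel"
    unfolding kernelization_def using polytime_kernel kernel_equiv kernel_size(1) by blast
  fix x assume x: "x \<in> lmda_instances_min_degree_2"
  then have "1 \<le> parameter x" by (auto simp: lmda_instances_min_degree_2_def parameter_def)
  \<comment> \<open>A positive parameter makes the exponent positive, so the power is at least its
    base.\<close>
  then have "exp3 (parameter x + 9) \<le> exp3 (parameter x + 9) ^ (2 * (parameter x)\<^sup>2 + 4 * parameter x)"
    by (intro self_le_power) (auto simp: exp3_def)
  then show "num_vertices (kernel x) \<le>
      exp3 (parameter x + 9) ^ (2 * (parameter x)\<^sup>2 + 4 * parameter x)"
    using kernel_size(2)[OF x] by linarith
qed

end
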